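(* In the setting described in the context, including the strong monotonicity/Lipschitz condition $(\mu_A+\mu_B+\mu_C)(1/L_A+1/L_B)>0$, fix any $\gamma\in(0,2\theta)$ and let $\alpha\in(0,1)$ be the linear convergence constant described in the context. Then, for any dataset $\mathcal D\in\Xi^N$, any $i\in\{1,\dots,N\}$ and any dataset $\mathcal D^i$ obtained from $\mathcal D$ by replacing its $i$-th sample, the iterates $\hat x_K$ (from $\mathcal D$) and $\hat x_K^i$ (from $\mathcal D^i$) of the data-driven Davis–Yin iteration, initialized at the same starting point $\hat z_0=\hat z_0^i\in\mathbb R^n$, satisfy $$\|\hat x_K-\hat x_K^i\|\le 2d_0\alpha^K+\frac{\varsigma}{\bar\mu N},$$ where $d_0=\sup_{\mathcal D\in\Xi^N}\operatorname{dist}(\hat z_0,\operatorname{fix}(\widehat T_{\mathcal D}))$ and $\bar\mu=\mu_A+\mu_B+\mu_C$.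
   Context: Let $n,d,N\in\mathbb N$ with $N\ge1$, $K\in\mathbb N$, $\gamma>0$, $\theta>0$, $\varsigma>0$; $\mathbb R^n$ carries the Euclidean inner product and norm. $A,B:\mathbb R^n\rightrightarrows\mathbb R^n$ are maximally monotone set-valued operators and $C:\mathbb R^n\to\mathbb R^n$ is $\theta$-cocoercive, where a map $F:\mathbb R^n\to\mathbb R^n$ is $\theta$-cocoercive if $\langle x-y,F(x)-F(y)\rangle\ge\theta\|F(x)-F(y)\|^2$ for all $x,y$. It is assumed that $\operatorname{zer}(A+B+C)=\{x:0\in A(x)+B(x)+C(x)\}\neq\emptyset$. The resolvent of a maximally monotone $A$ is $J_{\gamma A}=(\mathrm{Id}+\gamma A)^{-1}$ (single-valued, defined on all of $\mathbb R^n$). Oracle: $\Xi\subseteq\mathbb R^d$ is a sample space with a probability distribution $\mathbb P$, and $O:\mathbb R^n\times\Xi\to\mathbb R^n$ satisfies: (i) $\mathbb E_{\xi\sim\mathbb P}[O(x,\xi)]=C(x)$ for all $x$; (ii) $\|O(x,\xi)-O(x,\xi')\|\le\varsigma$ for all $x\in\mathbb R^n$, $\xi,\xi'\in\Xi$; (iii) $O(\cdot,\xi)$ is $\theta$-cocoercive for every $\xi\in\Xi$. For a dataset $\mathcal D=(\xi^1,\dots,\xi^N)\in\Xi^N$ put $\widehat C_{\mathcal D}(x)=\frac1N\sum_{j=1}^N O(x,\xi^j)$. From an initial point $\hat z_0\in\mathbb R^n$, the data-driven Davis–Yin iteration is $\hat x_t=J_{\gamma B}(\hat z_t)$, $\hat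 y_t=J_{\gamma A}(2\hat x_t-\hat z_t-\gamma\widehat C_{\mathcal D}(\hat x_t))$, $\hat z_{t+1}=\hat z_t+\hat y_t-\hat x_t$, i.e. $\hat z_{t+1}=\widehat T_{\mathcal D}(\hat z_t)$ with $\widehat T_{\mathcal D}(z)=z-J_{\gamma B}(z)+J_{\gamma A}\big(2J_{\gamma B}(z)-z-\gamma\widehat C_{\mathcal D}(J_{\gamma B}(z))\big)$; $\operatorname{fix}(\widehat T_{\mathcal D})$ is its set of fixed points and $\operatorname{dist}(x,\mathcal Y)$ is the Euclidean distance from $x$ to the set $\mathcal Y$. For $i\in\{1,\dots,N\}$, $\mathcal D^i$ denotes a dataset obtained from $\mathcal D$ by replacing its $i$-th sample with an arbitrary $\tilde\xi^i\in\Xi$, and superscript $i$ denotes the iterates run with $\mathcal D^i$. Additional assumptions: $\mu_A,\mu_B,\mu_C\ge0$ are strong monotonicity constants of $A,B,C$ (an operator $F$ is $\mu$-strongly monotone if $\langle x-y,u-v\rangle\ge\mu\|x-y\|^2$ for all $u\in F(x)$, $v\in F(y)$; $\mu=0$ means monotone). $L_A,L_B\in(0,+\infty]$ are Lipschitz constants of $A$ and $B$ ($L_A<\infty$ means that $A$ is single-valued and $L_A$-Lipschitz on $\mathbb R^n$; $1/L_A=0$ if $A$ is not Lipschitz; likewise for $B$). It is assumed that $(\mu_A+\mu_B+\mu_C)(1/L_A+1/L_B)>0$, that $O(\cdot,\xi)$ is $\mu_C$-strongly monotone for every $\xi\in\Xi$, and that $\operatorname{zer}(A+B+\widehat C_{\mathcal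 D})\ne\emptyset$ for every $\mathcal D\in\Xi^N$. Linear convergence constant: under these assumptions and $\gamma\in(0,2\theta)$, the known linear convergence theorem for Davis–Yin splitting provides a constant $\alpha\in(0,1)$, not depending on $\mathcal D$, such that for every $\mathcal D\in\Xi^N$ there is $z^\star_{\mathcal D}\in\operatorname{fix}(\widehat T_{\mathcal D})$ with $\|\hat z_k-z^\star_{\mathcal D}\|\le\alpha^k\|\hat z_0-z^\star_{\mathcal D}\|$ for every initial point $\hat z_0\in\mathbb R^n$ and every $k\in\mathbb N$. Here $\alpha$ denotes such a constant. *)

theory Defs
  imports "HOL-Probability.Probability"
begin

(* Set-valued operators on a space 'a are functions 'a => 'a set; a single-valued map F
   is regarded as the operator %x. {F x}. *)

definition strongly_monotone_op ::
    "real \<Rightarrow> ('a::real_inner \<Rightarrow> 'a set) \<Rightarrow> bool" where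
  "strongly_monotone_op \<mu> A \<longleftrightarrow>
     (\<forall>x y. \<forall>u\<in>A x. \<forall>v\<in>A y. (x - y) \<bullet> (u - v) \<ge> \<mu> * (norm (x - y))\<^sup>2)"

definition monotone_op :: "('a::real_inner \<Rightarrow> 'a set) \<Rightarrow> bool" where
  "monotone_op A \<longleftrightarrow>
     (\<forall>x y. \<forall>u\<in>A x. \<forall>v\<in>A y. (x - y) \<bullet> (u - v) \<ge> 0)"

definition maximal_monotone_op :: "('a::real_inner \<Rightarrow> 'a set) \<Rightarrow> bool" where
  "maximal_monotone_op A \<longleftrightarrow>
     monotone_op A \<and> (\<forall>A'. monotone_op A' \<and> (\<forall>x. A x \<subseteq> A' x) \<longrightarrow> A' = A)"

definition cocoercive :: "real \<Rightarrow> ('a::real_inner \<Rightarrow> 'a) \<Rightarrow> bool" where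
  "cocoercive \<theta> F \<longleftrightarrow>
     (\<forall>x y. (x - y) \<bullet> (F x - F y) \<ge> \<theta> * (norm (F x - F y))\<^sup>2)"

(* The constant L ranges over (0, \<infinity>]; L = \<infinity> expresses that nothing is required of A. *)
definition lipschitz_op ::
    "ereal \<Rightarrow> ('a::real_normed_vector \<Rightarrow> 'a set) \<Rightarrow> bool" where
  "lipschitz_op L A \<longleftrightarrow>
     (L < \<infinity> \<longrightarrow>
        (\<exists>f. A = (\<lambda>x. {f x}) \<and> (real_of_ereal L)-lipschitz_on UNIV f))"

definition zer :: "('a::zero \<Rightarrow> 'a set) \<Rightarrow> 'a set" where
  "zer F = {x. 0 \<in> F x}"

(* The value at z of the inverse of Id + \<gamma> A.  For \<gamma> > 0 and maximally monotone A on a Euclidean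
   space this inverse is single-valued with full domain (Minty), so the description is proper
   at every z. *)
definition resolvent ::
    "real \<Rightarrow> ('a::real_vector \<Rightarrow> 'a set) \<Rightarrow> 'a \<Rightarrow> 'a" where
  "resolvent \<gamma> A z = (THE x. z \<in> (\<lambda>u. x + \<gamma> *\<^sub>R u) ` A x)"

(* Datasets of size N are the extensional functions on the index set {1..N}. *)
definition datasets :: "nat \<Rightarrow> 'b set \<Rightarrow> (nat \<Rightarrow> 'b) set" where
  "datasets N \<Xi> = {1..N} \<rightarrow>\<^sub>E \<Xi>"

definition C_hat ::
    "('a::real_vector \<Rightarrow> 'b \<Rightarrow> 'a) \<Rightarrow> nat \<Rightarrow> (nat \<Rightarrow> 'b) \<Rightarrow> 'a \<Rightarrow> 'a" where
  "C_hat Orc N D x = (1 / real N) *\<^sub>R (\<Sum>j=1..N. Orc x (D j))"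

definition dy_map ::
    "real \<Rightarrow> ('a::real_vector \<Rightarrow> 'a set) \<Rightarrow> ('a \<Rightarrow> 'a set) \<Rightarrow> ('a \<Rightarrow> 'a) \<Rightarrow> 'a \<Rightarrow> 'a" where
  "dy_map \<gamma> A B F z =
     (let x = resolvent \<gamma> B z;
          y = resolvent \<gamma> A (2 *\<^sub>R x - z - \<gamma> *\<^sub>R F x)
      in z + y - x)"

definition dy_z ::
    "real \<Rightarrow> ('a::real_vector \<Rightarrow> 'a set) \<Rightarrow> ('a \<Rightarrow> 'a set) \<Rightarrow> ('a \<Rightarrow> 'a) \<Rightarrow> 'a \<Rightarrow> nat \<Rightarrow> 'a" where
  "dy_z \<gamma> A B F z0 t = (dy_map \<gamma> A B F ^^ t) z0"

definition dy_x ::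
    "real \<Rightarrow> ('a::real_vector \<Rightarrow> 'a set) \<Rightarrow> ('a \<Rightarrow> 'a set) \<Rightarrow> ('a \<Rightarrow> 'a) \<Rightarrow> 'a \<Rightarrow> nat \<Rightarrow> 'a" where
  "dy_x \<gamma> A B F z0 t = resolvent \<gamma> B (dy_z \<gamma> A B F z0 t)"

definition fix_set :: "('a \<Rightarrow> 'a) \<Rightarrow> 'a set" where
  "fix_set T = {z. T z = z}"

end

theory Submission
  imports Defs
begin

text \<open>
  By the assumed linear rate each empirical map has a unique fixed point, and resolvents are
  nonexpansive, so each of the two iterates is within \<open>\<alpha>\<^sup>K d\<^sub>0\<close> of the solution \<open>J\<^bsub>\<gamma>B\<^esub> z\<^sup>\<star>\<close> of its own
  inclusion \<open>0 \<in> A x + B x + C\<^sub>D x\<close>.  The two inclusions differ by a perturbation of norm at most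
  \<open>\<sigma> / N\<close>, and strong monotonicity with modulus \<open>\<mu>\<^sub>A + \<mu>\<^sub>B + \<mu>\<^sub>C\<close> bounds the distance of
  their solutions.  Resolvents are everywhere defined by Minty's theorem, which for finitely many
  points of the graph follows from minimising \<open>\<parallel>a - b\<parallel>\<^sup>2 / 4 + r\<close> over the convex hull of the
  triples \<open>(y, v, y \<bullet> v)\<close>, and in general from compactness.
\<close>

section \<open>Minty's theorem\<close>

text \<open>For fixed (y, v) in the graph, monotonicity against (y', v') is an affine inequality in
  the lifted triple (y', v', y' \<bullet> v'), so it passes to the convex hull. Doing this once for
  each of the two points gives 2 (a \<bullet> b) - r \<le> r.\<close>

lemma monotone_convex_hull_inner_le:
  fixes G :: "('a::real_inner \<times> 'a) set"
  assumes mono: "\<And>y v y' v'. (y, v) \<in> G \<Longrightarrow> (y', v') \<in> G \<Longrightarrow> (y - y') \<bullet> (v - v') \<ge> 0"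
    and mem: "(a, b, r) \<in> convex hull ((\<lambda>(y, v). (y, v, y \<bullet> v)) ` G)"
  shows "a \<bullet> b \<le> r"
proof -
  let ?S = "(\<lambda>(y, v). (y, v, y \<bullet> v)) ` G"
  have halfspace: "convex {(y :: 'a, v :: 'a, s :: real). y \<bullet> q + p \<bullet> v - s \<le> c}" for p q c
  proof -
    have "{(y, v, s). y \<bullet> q + p \<bullet> v - s \<le> c} = {x. (q, p, - 1) \<bullet> x \<le> c}"
      by (auto simp: inner_Pair inner_commute)
    then show ?thesis by (simp add: convex_halfspace_le)
  qed
  have step: "a \<bullet> v + y \<bullet> b - r \<le> y \<bullet> v" if "(y, v) \<in> G" for y v
  proof -
    have "?S \<subseteq> {(y', v', s). y' \<bullet> v + y \<bullet> v' - s \<le> y \<bullet> v}"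
      using mono[OF that] by (fastforce simp: inner_diff_left inner_diff_right)
    then have "convex hull ?S \<subseteq> {(y', v', s). y' \<bullet> v + y \<bullet> v' - s \<le> y \<bullet> v}"
      by (rule hull_minimal) (rule halfspace)
    with mem show ?thesis by auto
  qed
  have "?S \<subseteq> {(y, v, s). y \<bullet> b + a \<bullet> v - s \<le> r}"
    using step by fastforce
  then have "convex hull ?S \<subseteq> {(y, v, s). y \<bullet> b + a \<bullet> v - s \<le> r}"
    by (rule hull_minimal) (rule halfspace)
  with mem show ?thesis by auto
qed

text \<open>The pair (x, -x) can be adjoined to the graph. At a minimiser of \<open>h\<close> over
  the hull, the required inner product for a graph point is the slope of \<open>h\<close> towards
  the corresponding vertex plus the minimum value. The slope is nonnegative by minimality, the value
  by the preceding hull bound.\<close>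

lemma finite_monotone_extension:
  fixes G :: "('a::euclidean_space \<times> 'a) set"
  assumes fin: "finite G"
    and mono: "\<And>y v y' v'. (y, v) \<in> G \<Longrightarrow> (y', v') \<in> G \<Longrightarrow> (y - y') \<bullet> (v - v') \<ge> 0"
  shows "\<exists>x. \<forall>(y, v) \<in> G. (y - x) \<bullet> (v + x) \<ge> 0"
proof (cases "G = {}")
  case False
  define H where "H = convex hull ((\<lambda>(y, v). (y, v, y \<bullet> v)) ` G)"
  \<comment> \<open>The value at (a, b, r) is the maximum over x of r + x \<bullet> (a - b) - x
    \<bullet> x; at a lifted graph point (y, v, y \<bullet> v) the maximised expression is (y - x)
    \<bullet> (v + x).\<close>
  define h :: "'a \<times> 'a \<times> real \<Rightarrow> real"
    where "h = (\<lambda>p. (norm (fst p - fst (snd p)))\<^sup>2 / 4 + snd (snd p))"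
  have "compact H" "H \<noteq> {}"
    unfolding H_def using fin False by (auto intro: finite_imp_compact_convex_hull)
  moreover have "continuous_on H h"
    unfolding h_def by (intro continuous_intros) auto
  ultimately obtain p where "p \<in> H" and min: "\<And>q. q \<in> H \<Longrightarrow> h p \<le> h q"
    using continuous_attains_inf[of H h] by blast
  obtain a b r where p: "p = (a, b, r)" by (cases p)
  have "a \<bullet> b \<le> r"
    using monotone_convex_hull_inner_le[of G a b r] mono \<open>p \<in> H\<close> unfolding p H_def by blast
  moreover have "(norm (a - b))\<^sup>2 / 4 + a \<bullet> b = (norm (a + b))\<^sup>2 / 4"
    unfolding power2_norm_eq_inner
    by (simp add: inner_add_left inner_add_right inner_diff_left inner_diff_right
        inner_commute[of b a] field_simps)
  ultimately have h_nonneg: "(norm (a - b))\<^sup>2 / 4 + r \<ge> 0"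
    using zero_le_power2[of "norm (a + b)"] by linarith
  \<comment> \<open>This is the maximiser in that formula for \<open>h\<close> at the minimising
    triple.\<close>
  define x where "x = (1 / 2) *\<^sub>R (a - b)"
  have "(y - x) \<bullet> (v + x) \<ge> 0" if yv: "(y, v) \<in> G" for y v
  proof -
    define d where "d = (y - v) - (a - b)"
    \<comment> \<open>Along the segment from \<open>p\<close> to the vertex, \<open>h\<close> is
      quadratic in t: \<open>c\<close> is its slope at \<open>p\<close> and \<open>M\<close> its
      second-order coefficient.\<close>
    define c where "c = (a - b) \<bullet> d / 2 + (y \<bullet> v - r)"
    define M where "M = (norm d)\<^sup>2 / 4"
    have quad: "0 \<le> t * c + t\<^sup>2 * M" if t: "0 < t" "t \<le> 1" for t
    proof -
      have "(y, v, y \<bullet> v) \<in> H"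
        unfolding H_def using yv by (intro hull_inc) force
      with \<open>p \<in> H\<close> have "(1 - t) *\<^sub>R p + t *\<^sub>R (y, v, y \<bullet> v) \<in> H"
        unfolding H_def using t by (intro convexD convex_convex_hull) auto
      then have "h p \<le> h ((1 - t) *\<^sub>R p + t *\<^sub>R (y, v, y \<bullet> v))" by (rule min)
      also have "\<dots> = (norm (((1 - t) *\<^sub>R a + t *\<^sub>R y) - ((1 - t) *\<^sub>R b + t *\<^sub>R v)))\<^sup>2 / 4
          + ((1 - t) * r + t * (y \<bullet> v))"
        by (simp add: h_def p)
      also have "((1 - t) *\<^sub>R a + t *\<^sub>R y) - ((1 - t) *\<^sub>R b + t *\<^sub>R v) = (a - b) + t *\<^sub>R d"
        by (simp add: d_def algebra_simps)
      also have "(norm ((a - b) + t *\<^sub>R d))\<^sup>2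
          = (norm (a - b))\<^sup>2 + 2 * t * ((a - b) \<bullet> d) + t\<^sup>2 * (norm d)\<^sup>2"
        unfolding power2_norm_eq_inner
        by (simp add: inner_add_left inner_add_right inner_commute power2_eq_square)
      finally show ?thesis
        by (simp add: h_def p c_def M_def distrib_left left_diff_distrib right_diff_distrib
            add_divide_distrib)
    qed
    have "0 \<le> c"
    proof (rule ccontr)
      assume "\<not> 0 \<le> c"
      \<comment> \<open>The step is short enough that t * M \<le> - c / 2, so a negative slope would
        dominate. The summand 1 in M + 1 keeps the denominator positive when M = 0, and the minimum
        with 1 stays on the segment.\<close>
      define t where "t = min 1 (- c / (2 * (M + 1)))"
      have "M \<ge> 0" by (simp add: M_def)
      have t: "0 < t" "t \<le> 1"
        using \<open>\<not> 0 \<le> c\<close> \<open>M \<ge> 0\<close> by (auto simp: t_def intro!: divide_neg_pos)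
      have "t * M \<le> t * (M + 1)" using t by (simp add: algebra_simps)
      also have "\<dots> \<le> - c / (2 * (M + 1)) * (M + 1)"
        using \<open>M \<ge> 0\<close> by (intro mult_right_mono) (auto simp: t_def)
      also have "\<dots> = - c / 2" using \<open>M \<ge> 0\<close> by (simp add: field_simps)
      finally have "c + t * M < 0" using \<open>\<not> 0 \<le> c\<close> by simp
      then have "t * (c + t * M) < 0" using t by (simp add: mult_pos_neg)
      with quad[OF t] show False by (simp add: algebra_simps power2_eq_square)
    qed
    have ab: "a - b = 2 *\<^sub>R x" by (simp add: x_def)
    have "(y - x) \<bullet> (v + x) = y \<bullet> v + x \<bullet> (y - v) - x \<bullet> x"
      by (simp add: algebra_simps inner_commute)
    also have "\<dots> = c + ((norm (a - b))\<^sup>2 / 4 + r)"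
      unfolding c_def d_def ab power2_norm_eq_inner
    by (simp add: inner_diff_left inner_diff_right inner_commute diff_divide_distrib)
    finally show ?thesis using \<open>0 \<le> c\<close> h_nonneg by simp
  qed
  then show ?thesis by blast
qed auto

text \<open>The points x admissible for one pair (y, v) form the closed ball having the segment from
  y to -v as a diameter. These sets are compact, and the finite case supplies the finite
  intersection property.\<close>

lemma monotone_extension:
  fixes G :: "('a::euclidean_space \<times> 'a) set"
  assumes mono: "\<And>y v y' v'. (y, v) \<in> G \<Longrightarrow> (y', v') \<in> G \<Longrightarrow> (y - y') \<bullet> (v - v') \<ge> 0"
  shows "\<exists>x. \<forall>(y, v) \<in> G. (y - x) \<bullet> (v + x) \<ge> 0"
proof -
  define F where "F = (\<lambda>(y, v). {x :: 'a. (y - x) \<bullet> (v + x) \<ge> 0})"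
  have "compact S" if "S \<in> F ` G" for S
  proof -
    from that obtain y v where S: "S = {x. (y - x) \<bullet> (v + x) \<ge> 0}" by (auto simp: F_def)
    \<comment> \<open>The summand 1 makes norm x at least 1 under the negated bound, so that the
      constant term can be absorbed into a multiple of norm x.\<close>
    have "norm x \<le> norm (y - v) + norm y * norm v + 1" if "x \<in> S" for x
    proof (rule ccontr)
      assume *: "\<not> ?thesis"
      have "norm x * norm x = x \<bullet> x" by (simp add: norm_eq_sqrt_inner)
      also have "\<dots> \<le> x \<bullet> (y - v) + y \<bullet> v"
        using that by (simp add: S algebra_simps inner_commute)
      also have "\<dots> \<le> norm x * norm (y - v) + norm y * norm v"
        by (intro add_mono norm_cauchy_schwarz)
      also have "\<dots> \<le> norm x * norm (y - v) + norm x * (norm y * norm v)"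
      proof -
        have "1 \<le> norm x" using * by (smt (verit) norm_ge_zero mult_nonneg_nonneg)
        then show ?thesis
          using mult_right_mono[of 1 "norm x" "norm y * norm v"] by simp
      qed
      also have "\<dots> = norm x * (norm (y - v) + norm y * norm v)" by (simp add: algebra_simps)
      finally have "norm x * norm x \<le> norm x * (norm (y - v) + norm y * norm v)" .
      moreover have "0 < norm x" using * by (smt (verit) norm_ge_zero mult_nonneg_nonneg)
      ultimately have "norm x \<le> norm (y - v) + norm y * norm v" by simp
      with * show False by simp
    qed
    then have "bounded S" by (auto simp: bounded_iff)
    moreover have "closed S"
      unfolding S by (intro closed_Collect_le continuous_intros)
    ultimately show ?thesis by (simp add: compact_eq_bounded_closed)
  qed
  moreover have "\<Inter> \<F> \<noteq> {}" if \<F>: "finite \<F>" "\<F> \<subseteq> F ` G" for \<F>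
  proof -
    obtain G' where G': "G' \<subseteq> G" "finite G'" "\<F> = F ` G'"
      using finite_subset_image[OF \<F>] by blast
    have "\<exists>x. \<forall>(y, v) \<in> G'. (y - x) \<bullet> (v + x) \<ge> 0"
      using G'(1) mono by (intro finite_monotone_extension[OF G'(2)]) blast
    then show ?thesis unfolding G'(3) by (fastforce simp: F_def)
  qed
  ultimately have "\<Inter> (F ` G) \<noteq> {}" by (rule compact_fip_Heine_Borel)
  then show ?thesis by (fastforce simp: F_def)
qed

text \<open>Adjoining the single pair (x, w) to the graph keeps it monotone, so maximality forces
  the pair to be there already.\<close>

lemma maximal_monotone_opD:
  assumes max: "maximal_monotone_op A"
    and ge: "\<And>y v. v \<in> A y \<Longrightarrow> (y - x) \<bullet> (v - w) \<ge> 0"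
  shows "w \<in> A x"
proof -
  define A' where "A' = A(x := insert w (A x))"
  have cases: "v \<in> A y \<or> (y = x \<and> v = w)" if "v \<in> A' y" for y v
    using that by (auto simp: A'_def split: if_splits)
  have mono: "(y - y') \<bullet> (v - v') \<ge> 0" if "v \<in> A y" "v' \<in> A y'" for y y' v v'
    using max that by (auto simp: maximal_monotone_op_def monotone_op_def)
  have "(y - y') \<bullet> (v - v') \<ge> 0" if "v \<in> A' y" "v' \<in> A' y'" for y y' v v'
  proof -
    have "(x - y') \<bullet> (w - v') = (y' - x) \<bullet> (v' - w)" by (simp add: algebra_simps)
    then show ?thesis using cases[OF that(1)] cases[OF that(2)] mono ge by fastforce
  qed
  then have "monotone_op A'" by (auto simp: monotone_op_def)
  moreover have "\<forall>y. A y \<subseteq> A' y" by (auto simp: A'_def)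
  ultimately have "A' = A" using max by (auto simp: maximal_monotone_op_def)
  moreover have "w \<in> A' x" by (simp add: A'_def)
  ultimately show ?thesis by simp
qed

theorem Minty:
  fixes A :: "'a::euclidean_space \<Rightarrow> 'a set"
  assumes max: "maximal_monotone_op A" and "\<gamma> > 0"
  shows "\<exists>x. \<exists>u\<in>A x. z = x + \<gamma> *\<^sub>R u"
proof -
  \<comment> \<open>Scaling by \<gamma> and shifting by z turns z = x + \<gamma> w into the
    condition that the value adjoined at x is -x, the form treated by
    \<open>monotone_extension\<close>.\<close>
  let ?G = "{(y, \<gamma> *\<^sub>R v - z) | y v. v \<in> A y}"
  have "(y - y') \<bullet> (v - v') \<ge> 0" if G: "(y, v) \<in> ?G" "(y', v') \<in> ?G" for y v y' v'
  proof -
    from G obtain u u' where u: "u \<in> A y" "u' \<in> A y'" "v = \<gamma> *\<^sub>R u - z" "v' = \<gamma> *\<^sub>R u' - z"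
      by auto
    have "(y - y') \<bullet> (u - u') \<ge> 0"
      using max u(1,2) by (auto simp: maximal_monotone_op_def monotone_op_def)
    moreover have "(y - y') \<bullet> (v - v') = \<gamma> * ((y - y') \<bullet> (u - u'))"
      by (simp add: u algebra_simps)
    ultimately show ?thesis using \<open>\<gamma> > 0\<close> by simp
  qed
  then obtain x where x: "\<forall>(y, v) \<in> ?G. (y - x) \<bullet> (v + x) \<ge> 0"
    using monotone_extension[of ?G] by blast
  define w where "w = (1 / \<gamma>) *\<^sub>R (z - x)"
  have gw: "\<gamma> *\<^sub>R w = z - x" using \<open>\<gamma> > 0\<close> by (simp add: w_def)
  have "w \<in> A x"
  proof (rule maximal_monotone_opD[OF max])
    fix y v assume "v \<in> A y"
    then have "(y - x) \<bullet> (\<gamma> *\<^sub>R v - z + x) \<ge> 0" using x by blast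
    also have "\<gamma> *\<^sub>R v - z + x = \<gamma> *\<^sub>R (v - w)" by (simp add: scaleR_diff_right gw)
    finally show "(y - x) \<bullet> (v - w) \<ge> 0" using \<open>\<gamma> > 0\<close> by (simp add: zero_le_mult_iff)
  qed
  moreover have "z = x + \<gamma> *\<^sub>R w" by (simp add: gw)
  ultimately show ?thesis by blast
qed

section \<open>Resolvents\<close>

text \<open>Phrased for graph points rather than resolvents, so that it yields both uniqueness of
  the resolvent value and its nonexpansiveness.\<close>

lemma monotone_op_nonexpansive:
  assumes mono: "monotone_op A" and "\<gamma> > 0" and "u \<in> A x" "v \<in> A y"
  shows "norm (x - y) \<le> norm ((x + \<gamma> *\<^sub>R u) - (y + \<gamma> *\<^sub>R v))"
proof -
  have "(x - y) \<bullet> (u - v) \<ge> 0" using assms by (auto simp: monotone_op_def)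
  then have "0 \<le> \<gamma> * ((x - y) \<bullet> (u - v))" using \<open>\<gamma> > 0\<close> by simp
  moreover have "(x - y) \<bullet> ((x + \<gamma> *\<^sub>R u) - (y + \<gamma> *\<^sub>R v))
      = (norm (x - y))\<^sup>2 + \<gamma> * ((x - y) \<bullet> (u - v))"
    by (simp add: power2_norm_eq_inner algebra_simps)
  ultimately have "(norm (x - y))\<^sup>2 \<le> (x - y) \<bullet> ((x + \<gamma> *\<^sub>R u) - (y + \<gamma> *\<^sub>R v))" by simp
  also have "\<dots> \<le> norm (x - y) * norm ((x + \<gamma> *\<^sub>R u) - (y + \<gamma> *\<^sub>R v))"
    by (rule norm_cauchy_schwarz)
  finally show ?thesis
    by (cases "x = y") (auto simp: power2_eq_square)
qed

text \<open>Existence by \<open>Minty\<close> and uniqueness by nonexpansiveness make the definite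
  description in \<open>resolvent\<close> proper.\<close>

lemma resolvent_mem:
  fixes A :: "'a::euclidean_space \<Rightarrow> 'a set"
  assumes max: "maximal_monotone_op A" and "\<gamma> > 0"
  shows "\<exists>u\<in>A (resolvent \<gamma> A z). z = resolvent \<gamma> A z + \<gamma> *\<^sub>R u"
proof -
  have "\<exists>!x. z \<in> (\<lambda>u. x + \<gamma> *\<^sub>R u) ` A x"
  proof (rule ex_ex1I)
    show "\<exists>x. z \<in> (\<lambda>u. x + \<gamma> *\<^sub>R u) ` A x" using Minty[OF assms] by blast
  next
    fix x y assume "z \<in> (\<lambda>u. x + \<gamma> *\<^sub>R u) ` A x" "z \<in> (\<lambda>u. y + \<gamma> *\<^sub>R u) ` A y"
    then obtain u v where "u \<in> A x" "v \<in> A y" "x + \<gamma> *\<^sub>R u = z" "y + \<gamma> *\<^sub>R v = z" by auto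
    then show "x = y"
      using monotone_op_nonexpansive[of A \<gamma> u x v y] assms
      by (simp add: maximal_monotone_op_def)
  qed
  from theI'[OF this] show ?thesis unfolding resolvent_def by blast
qed

lemma resolvent_nonexpansive:
  fixes A :: "'a::euclidean_space \<Rightarrow> 'a set"
  assumes "maximal_monotone_op A" "\<gamma> > 0"
  shows "norm (resolvent \<gamma> A z - resolvent \<gamma> A z') \<le> norm (z - z')"
proof -
  obtain u where "u \<in> A (resolvent \<gamma> A z)" "resolvent \<gamma> A z + \<gamma> *\<^sub>R u = z"
    using resolvent_mem[OF assms, of z] by metis
  moreover obtain v where "v \<in> A (resolvent \<gamma> A z')" "resolvent \<gamma> A z' + \<gamma> *\<^sub>R v = z'"
    using resolvent_mem[OF assms, of z'] by metis
  ultimately show ?thesis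
    using monotone_op_nonexpansive[of A \<gamma> u "resolvent \<gamma> A z" v "resolvent \<gamma> A z'"] assms
    by (simp add: maximal_monotone_op_def)
qed

section \<open>Davis--Yin fixed points\<close>

text \<open>At a fixed point the two resolvent outputs coincide; adding their defining inclusions at
  this common point cancels z.\<close>

lemma dy_fixed_point_solution:
  fixes A B :: "'a::euclidean_space \<Rightarrow> 'a set"
  assumes "maximal_monotone_op A" "maximal_monotone_op B" "\<gamma> > 0"
    and fixed: "z \<in> fix_set (dy_map \<gamma> A B F)"
  defines "x \<equiv> resolvent \<gamma> B z"
  shows "\<exists>a\<in>A x. \<exists>b\<in>B x. a + b + F x = 0"
proof -
  have y: "resolvent \<gamma> A (2 *\<^sub>R x - z - \<gamma> *\<^sub>R F x) = x"
    using fixed by (simp add: fix_set_def dy_map_def Let_def x_def algebra_simps)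
  obtain b where b: "b \<in> B x" "z = x + \<gamma> *\<^sub>R b"
    using resolvent_mem[OF assms(2,3), of z] unfolding x_def by blast
  obtain a where a: "a \<in> A x" "2 *\<^sub>R x - z - \<gamma> *\<^sub>R F x = x + \<gamma> *\<^sub>R a"
    using resolvent_mem[OF assms(1,3), of "2 *\<^sub>R x - z - \<gamma> *\<^sub>R F x"] unfolding y by blast
  have "\<gamma> *\<^sub>R (a + b + F x) = 0"
    using a(2) by (simp add: b(2) algebra_simps scaleR_2)
  then have "a + b + F x = 0" using \<open>\<gamma> > 0\<close> by simp
  with a(1) b(1) show ?thesis by blast
qed

section \<open>Sensitivity of the empirical inclusion to one sample\<close>

lemma strongly_monotone_solution_perturbation:
  fixes A B :: "'a::real_inner \<Rightarrow> 'a set"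
  assumes "strongly_monotone_op \<mu>A A" "strongly_monotone_op \<mu>B B"
    and "strongly_monotone_op \<mu>C (\<lambda>x. {F x})"
    and pos: "\<mu>A + \<mu>B + \<mu>C > 0"
    and x: "a \<in> A x" "b \<in> B x" "a + b + F x = 0"
    and x': "a' \<in> A x'" "b' \<in> B x'" "a' + b' + F' x' = 0"
  shows "norm (x - x') \<le> norm (F x' - F' x') / (\<mu>A + \<mu>B + \<mu>C)"
proof -
  have "(\<mu>A + \<mu>B + \<mu>C) * (norm (x - x'))\<^sup>2
      \<le> (x - x') \<bullet> (a - a') + (x - x') \<bullet> (b - b') + (x - x') \<bullet> (F x - F x')"
    using assms unfolding strongly_monotone_op_def
    by (simp add: distrib_right add_mono)
  \<comment> \<open>Both solution equations make their sums vanish; exchanging F x' for F' x' leaves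
    only the perturbation at x'.\<close>
  also have "\<dots> = (x - x') \<bullet> ((a + b + F x) - (a' + b' + F' x') - (F x' - F' x'))"
    by (simp add: algebra_simps)
  also have "\<dots> = (x - x') \<bullet> - (F x' - F' x')" unfolding x(3) x'(3) by simp
  also have "\<dots> \<le> norm (x - x') * norm (F x' - F' x')"
    using norm_cauchy_schwarz[of "x - x'" "- (F x' - F' x')"] by (simp only: norm_minus_cancel)
  finally have "norm (x - x') * ((\<mu>A + \<mu>B + \<mu>C) * norm (x - x'))
      \<le> norm (x - x') * norm (F x' - F' x')"
    by (simp add: power2_eq_square algebra_simps)
  then have "(\<mu>A + \<mu>B + \<mu>C) * norm (x - x') \<le> norm (F x' - F' x')"
    by (cases "x = x'") auto
  then show ?thesis using pos by (simp add: field_simps)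
qed

lemma strongly_monotone_C_hat:
  assumes "N \<ge> 1" and "D \<in> datasets N \<Xi>"
    and strong: "\<And>\<xi>. \<xi> \<in> \<Xi> \<Longrightarrow> strongly_monotone_op \<mu> (\<lambda>x. {Orc x \<xi>})"
  shows "strongly_monotone_op \<mu> (\<lambda>x. {C_hat Orc N D x})"
proof -
  have "\<mu> * (norm (x - y))\<^sup>2 \<le> (x - y) \<bullet> (C_hat Orc N D x - C_hat Orc N D y)" for x y
  proof -
    have "real N * (\<mu> * (norm (x - y))\<^sup>2) = (\<Sum>j=1..N. \<mu> * (norm (x - y))\<^sup>2)" by simp
    also have "\<dots> \<le> (\<Sum>j=1..N. (x - y) \<bullet> (Orc x (D j) - Orc y (D j)))"
    proof (rule sum_mono)
      fix j assume "j \<in> {1..N}"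
      then have "D j \<in> \<Xi>" using assms(2) by (auto simp: datasets_def)
      then show "\<mu> * (norm (x - y))\<^sup>2 \<le> (x - y) \<bullet> (Orc x (D j) - Orc y (D j))"
        using strong by (auto simp: strongly_monotone_op_def)
    qed
    also have "\<dots> = real N * ((x - y) \<bullet> (C_hat Orc N D x - C_hat Orc N D y))"
      using assms(1)
      by (simp add: C_hat_def inner_sum_right inner_diff_right sum_subtractf
          flip: scaleR_diff_right)
    finally show ?thesis using assms(1) by simp
  qed
  then show ?thesis by (simp add: strongly_monotone_op_def)
qed

lemma norm_C_hat_update_le:
  assumes D: "D \<in> datasets N \<Xi>" and i: "i \<in> {1..N}" and "\<xi>' \<in> \<Xi>"
    and bound: "\<And>\<xi> \<xi>'. \<xi> \<in> \<Xi> \<Longrightarrow> \<xi>' \<in> \<Xi> \<Longrightarrow> norm (Orc x \<xi> - Orc x \<xi>') \<le> \<sigma>"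
  shows "norm (C_hat Orc N D x - C_hat Orc N (D(i := \<xi>')) x) \<le> \<sigma> / real N"
proof -
  have "C_hat Orc N D x - C_hat Orc N (D(i := \<xi>')) x
      = (1 / real N) *\<^sub>R (\<Sum>j=1..N. Orc x (D j) - Orc x ((D(i := \<xi>')) j))"
    unfolding C_hat_def by (simp add: sum_subtractf scaleR_diff_right)
  also have "(\<Sum>j=1..N. Orc x (D j) - Orc x ((D(i := \<xi>')) j))
      = (\<Sum>j=1..N. if j = i then Orc x (D i) - Orc x \<xi>' else 0)"
    by (intro sum.cong) auto
  also have "\<dots> = Orc x (D i) - Orc x \<xi>'" using i by simp
  finally have diff: "C_hat Orc N D x - C_hat Orc N (D(i := \<xi>')) x
      = (1 / real N) *\<^sub>R (Orc x (D i) - Orc x \<xi>')" .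
  have "norm (C_hat Orc N D x - C_hat Orc N (D(i := \<xi>')) x)
      = norm (Orc x (D i) - Orc x \<xi>') / real N"
    unfolding diff by simp
  also have "\<dots> \<le> \<sigma> / real N"
    using assms by (intro divide_right_mono bound) (auto simp: datasets_def)
  finally show ?thesis .
qed

section \<open>Uniqueness of fixed points and the stability bound\<close>

text \<open>The rate with k = 1, started at another fixed point, contradicts \<alpha> < 1.
  Uniqueness later identifies the distance to the fixed-point set with the distance to
  \<open>zs\<close>.\<close>

lemma fix_set_eq_singleton:
  assumes "zs \<in> fix_set (dy_map \<gamma> A B F)" "\<alpha> < 1"
    and rate: "\<And>z k. norm (dy_z \<gamma> A B F z k - zs) \<le> \<alpha> ^ k * norm (z - zs)"
  shows "fix_set (dy_map \<gamma> A B F) = {zs}"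
proof -
  have "z = zs" if "z \<in> fix_set (dy_map \<gamma> A B F)" for z
  proof (rule ccontr)
    assume "z \<noteq> zs"
    have "norm (z - zs) \<le> \<alpha> * norm (z - zs)"
      using rate[of z 1] that by (simp add: dy_z_def fix_set_def)
    also have "\<dots> < norm (z - zs)" using \<open>z \<noteq> zs\<close> \<open>\<alpha> < 1\<close> by simp
    finally show False by simp
  qed
  with assms(1) show ?thesis by blast
qed

theorem proposition3:
  fixes A B :: "real ^ 'n \<Rightarrow> (real ^ 'n) set"
    and C :: "real ^ 'n \<Rightarrow> real ^ 'n"
    and \<Xi> :: "(real ^ 'd) set"
    and P :: "(real ^ 'd) measure"
    and Orc :: "real ^ 'n \<Rightarrow> real ^ 'd \<Rightarrow> real ^ 'n"
    and N K i :: nat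
    and \<gamma> \<theta> \<sigma> \<mu>A \<mu>B \<mu>C \<alpha> :: real
    and LA LB :: ereal
    and D :: "nat \<Rightarrow> real ^ 'd"
    and \<xi>' :: "real ^ 'd"
    and z0 :: "real ^ 'n"
  assumes N: "N \<ge> 1"
    and \<theta>: "\<theta> > 0"
    and \<sigma>: "\<sigma> > 0"
    and \<gamma>: "0 < \<gamma>" "\<gamma> < 2 * \<theta>"
    and maxmon: "maximal_monotone_op A" "maximal_monotone_op B"
    and C_coco: "cocoercive \<theta> C"
    and zer_C: "zer (\<lambda>x. A x + B x + {C x}) \<noteq> {}"
    and P: "prob_space P" "sets P = sets (restrict_space borel \<Xi>)"
    and oracle_mean: "\<And>x. integrable P (Orc x)" "\<And>x. (\<integral>\<xi>. Orc x \<xi> \<partial>P) = C x"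
    and oracle_bound: "\<And>x \<xi> \<xi>'. \<xi> \<in> \<Xi> \<Longrightarrow> \<xi>' \<in> \<Xi> \<Longrightarrow> norm (Orc x \<xi> - Orc x \<xi>') \<le> \<sigma>"
    and oracle_coco: "\<And>\<xi>. \<xi> \<in> \<Xi> \<Longrightarrow> cocoercive \<theta> (\<lambda>x. Orc x \<xi>)"
    and \<mu>_nonneg: "\<mu>A \<ge> 0" "\<mu>B \<ge> 0" "\<mu>C \<ge> 0"
    and \<mu>A: "strongly_monotone_op \<mu>A A"
    and \<mu>B: "strongly_monotone_op \<mu>B B"
    and \<mu>C: "strongly_monotone_op \<mu>C (\<lambda>x. {C x})"
    and L_pos: "LA > 0" "LB > 0"
    and LA: "lipschitz_op LA A"
    and LB: "lipschitz_op LB B"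
    and regularity: "ereal (\<mu>A + \<mu>B + \<mu>C) * (1 / LA + 1 / LB) > 0"
    and oracle_strong: "\<And>\<xi>. \<xi> \<in> \<Xi> \<Longrightarrow> strongly_monotone_op \<mu>C (\<lambda>x. {Orc x \<xi>})"
    and zer_C_hat: "\<And>D. D \<in> datasets N \<Xi> \<Longrightarrow>
          zer (\<lambda>x. A x + B x + {C_hat Orc N D x}) \<noteq> {}"
    and \<alpha>: "0 < \<alpha>" "\<alpha> < 1"
    and linear_convergence: "\<And>D. D \<in> datasets N \<Xi> \<Longrightarrow>
          \<exists>zs \<in> fix_set (dy_map \<gamma> A B (C_hat Orc N D)).
            \<forall>z k. norm (dy_z \<gamma> A B (C_hat Orc N D) z k - zs) \<le> \<alpha> ^ k * norm (z - zs)"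
    and D: "D \<in> datasets N \<Xi>"
    and i: "i \<in> {1..N}"
    and \<xi>': "\<xi>' \<in> \<Xi>"
  shows "ereal (norm (dy_x \<gamma> A B (C_hat Orc N D) z0 K
                      - dy_x \<gamma> A B (C_hat Orc N (D(i := \<xi>'))) z0 K))
         \<le> 2 * (SUP D' \<in> datasets N \<Xi>.
                   ereal (infdist z0 (fix_set (dy_map \<gamma> A B (C_hat Orc N D')))))
             * ereal (\<alpha> ^ K)
           + ereal (\<sigma> / ((\<mu>A + \<mu>B + \<mu>C) * real N))"
proof -
  define T where "T = (\<lambda>D. dy_map \<gamma> A B (C_hat Orc N D))"
  define S where "S = (SUP D' \<in> datasets N \<Xi>. ereal (infdist z0 (fix_set (T D'))))"
  define \<mu> where "\<mu> = \<mu>A + \<mu>B + \<mu>C"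
  \<comment> \<open>In \<open>ereal\<close> a product with 0 is 0, even if the other factor is
    infinite, so the strict inequality excludes \<mu> = 0.\<close>
  have "\<mu> \<noteq> 0" using regularity by (auto simp: \<mu>_def simp flip: zero_ereal_def)
  then have \<mu>_pos: "\<mu> > 0" using \<mu>_nonneg by (simp add: \<mu>_def)
  have D'_mem: "D(i := \<xi>') \<in> datasets N \<Xi>"
    using D i \<xi>' by (auto simp: datasets_def PiE_def extensional_def)
  have solution: "\<exists>zs. zs \<in> fix_set (T D) \<and> ereal (norm (z0 - zs)) \<le> S
      \<and> norm (dy_x \<gamma> A B (C_hat Orc N D) z0 K - resolvent \<gamma> B zs) \<le> \<alpha> ^ K * norm (z0 - zs)"
    if D: "D \<in> datasets N \<Xi>" for D
  proof -
    obtain zs where zs: "zs \<in> fix_set (T D)"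
      and rate: "\<And>z k. norm (dy_z \<gamma> A B (C_hat Orc N D) z k - zs) \<le> \<alpha> ^ k * norm (z - zs)"
      using linear_convergence[OF D] unfolding T_def by blast
    have "fix_set (T D) = {zs}"
      using fix_set_eq_singleton[OF zs[unfolded T_def] \<alpha>(2) rate] by (simp add: T_def)
    \<comment> \<open>Since the set is a nonempty singleton, \<open>infdist\<close> is a genuine
      distance here and not its default 0 for the empty set.\<close>
    then have "norm (z0 - zs) = infdist z0 (fix_set (T D))" by (simp add: dist_norm)
    then have "ereal (norm (z0 - zs)) \<le> S" unfolding S_def using D by (auto intro: SUP_upper)
    moreover have "norm (dy_x \<gamma> A B (C_hat Orc N D) z0 K - resolvent \<gamma> B zs)
        \<le> \<alpha> ^ K * norm (z0 - zs)"
      unfolding dy_x_def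
      using resolvent_nonexpansive[OF maxmon(2) \<gamma>(1)] rate by (rule order_trans)
    ultimately show ?thesis using zs by blast
  qed
  obtain z where z: "z \<in> fix_set (T D)" "ereal (norm (z0 - z)) \<le> S"
    "norm (dy_x \<gamma> A B (C_hat Orc N D) z0 K - resolvent \<gamma> B z) \<le> \<alpha> ^ K * norm (z0 - z)"
    using solution[OF D] by blast
  obtain z' where z': "z' \<in> fix_set (T (D(i := \<xi>')))" "ereal (norm (z0 - z')) \<le> S"
    "norm (dy_x \<gamma> A B (C_hat Orc N (D(i := \<xi>'))) z0 K - resolvent \<gamma> B z')
      \<le> \<alpha> ^ K * norm (z0 - z')"
    using solution[OF D'_mem] by blast
  define x where "x = resolvent \<gamma> B z"
  define x' where "x' = resolvent \<gamma> B z'"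
  obtain a b where ab: "a \<in> A x" "b \<in> B x" "a + b + C_hat Orc N D x = 0"
    using dy_fixed_point_solution[OF maxmon \<gamma>(1) z(1)[unfolded T_def]] by (auto simp: x_def)
  obtain a' b' where ab': "a' \<in> A x'" "b' \<in> B x'" "a' + b' + C_hat Orc N (D(i := \<xi>')) x' = 0"
    using dy_fixed_point_solution[OF maxmon \<gamma>(1) z'(1)[unfolded T_def]] by (auto simp: x'_def)
  \<comment> \<open>Strong monotonicity is taken for the original dataset, so the two empirical maps
    are compared at the solution x' of the modified one.\<close>
  have C_hat_strong: "strongly_monotone_op \<mu>C (\<lambda>x. {C_hat Orc N D x})"
    using N D oracle_strong by (rule strongly_monotone_C_hat)
  have "norm (x - x') \<le> norm (C_hat Orc N D x' - C_hat Orc N (D(i := \<xi>')) x') / \<mu>"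
    unfolding \<mu>_def
    using strongly_monotone_solution_perturbation[OF \<mu>A \<mu>B C_hat_strong _ ab(1,2)]
      \<mu>_pos[unfolded \<mu>_def] ab(3) ab' by blast
  also have "\<dots> \<le> \<sigma> / real N / \<mu>"
    using norm_C_hat_update_le[where Orc = Orc, OF D i \<xi>' oracle_bound] \<mu>_pos
    by (intro divide_right_mono) auto
  also have "\<dots> = \<sigma> / (\<mu> * real N)" by (simp add: mult.commute)
  finally have stable: "norm (x - x') \<le> \<sigma> / (\<mu> * real N)" .
  let ?X = "dy_x \<gamma> A B (C_hat Orc N D) z0 K"
  let ?X' = "dy_x \<gamma> A B (C_hat Orc N (D(i := \<xi>'))) z0 K"
  have "norm (?X - ?X') \<le> norm (?X - x) + norm (x - x') + norm (?X' - x')"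
    using norm_triangle_ineq[of "?X - x" "x - x'"]
      norm_triangle_ineq4[of "(?X - x) + (x - x')" "?X' - x'"] by simp
  then have main: "norm (?X - ?X')
      \<le> \<alpha> ^ K * norm (z0 - z) + \<alpha> ^ K * norm (z0 - z') + \<sigma> / (\<mu> * real N)"
    using z(3) z'(3) stable unfolding x_def x'_def by linarith
  have "ereal (norm (?X - ?X')) \<le> 2 * S * ereal (\<alpha> ^ K) + ereal (\<sigma> / (\<mu> * real N))"
  \<comment> \<open>The supremum is an extended real. If it is infinite, the right-hand side is
    infinite because \<alpha> ^ K > 0; the value minus infinity is excluded by the real lower bound
    norm (z0 - z).\<close>
  proof (cases S)
    case (real s)
    have "\<alpha> ^ K * norm (z0 - z) \<le> \<alpha> ^ K * s" "\<alpha> ^ K * norm (z0 - z') \<le> \<alpha> ^ K * s"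
      using z(2) z'(2) \<alpha> by (auto simp: real)
    moreover have "2 * s * \<alpha> ^ K = \<alpha> ^ K * s + \<alpha> ^ K * s" by simp
    ultimately have "norm (?X - ?X') \<le> 2 * s * \<alpha> ^ K + \<sigma> / (\<mu> * real N)"
      using main by linarith
    then show ?thesis by (simp add: real)
  next
    case PInf
    then show ?thesis using \<alpha> by simp
  next
    case MInf
    then show ?thesis using z(2) by simp
  qed
  then show ?thesis by (simp add: S_def T_def \<mu>_def)
qed

end
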